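(* Let $m$ and $n$ be odd positive integers and let $d$ be an integer. Then: 1. If $n\geq 3$, then $\tau_{d}(C_n)=2d+1$ whenever $1\leq d\leq \frac{n-1}{2}$ (this is the case $m=1$, as $P_1\square C_n\cong C_n$). 2. If $m\geq 3$ and $n\geq 3$, then: (a) $\max\{3d,\, 4d-n+2\}\leq \tau_{d}(P_m\square C_n)\leq 4d+1$ whenever $1\leq d\leq \frac{m-3}{2}$; (b) $\max\{3d,\, 4d-n+2\}\leq \tau_{d}(P_m\square C_n)\leq 3d+\frac{m+1}{2}$ whenever $\frac{m-1}{2}\leq d\leq \frac{m-5}{2}+n$; (c) $\tau_{d}(P_m\square C_n)=4d-n+2$ whenever $\frac{m-3}{2}+n\leq d\leq \frac{mn-1}{2}$.
   Context: All graphs are simple, finite and undirected. A matching of a graph $G$ is a set of edges no two of which share an endpoint; a maximum matching is a matching of largest cardinality, and this cardinality is denoted $\nu(G)$. For an integer $d$ with $1\leq d\leq \nu(G)$, a $d$-transversal set of $G$ is a set $T\subseteq E(G)$ such that $|T\cap M|\geq d$ for every maximum matching $M$ of $G$; $\tau_d(G)$ denotes the minimum cardinality of a $d$-transversal set of $G$. $P_m$ is the path with $m$ vertices, $C_n$ is the cycle with $n$ vertices ($n\ge 3$). The Cartesian product $G\square H$ has vertex set $V(G)\times V(H)$, with $(g_1,h_1)$ and $(g_2,h_2)$ adjacent iff either $g_1=g_2$ and $h_1h_2\in E(H)$, or $g_1g_2\in E(G)$ and $h_1=h_2$. *)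

theory Defs
  imports Main
begin

record 'a graph =
  verts :: "'a set"
  edges :: "'a set set"

definition simple_graph :: "'a graph \<Rightarrow> bool" where
  "simple_graph G \<longleftrightarrow> finite (verts G) \<and> (\<forall>e\<in>edges G. e \<subseteq> verts G \<and> card e = 2)"

definition matching :: "'a graph \<Rightarrow> 'a set set \<Rightarrow> bool" where
  "matching G M \<longleftrightarrow> M \<subseteq> edges G \<and> (\<forall>e\<in>M. \<forall>f\<in>M. e \<noteq> f \<longrightarrow> e \<inter> f = {})"

definition maximum_matching :: "'a graph \<Rightarrow> 'a set set \<Rightarrow> bool" where
  "maximum_matching G M \<longleftrightarrow> matching G M \<and> (\<forall>N. matching G N \<longrightarrow> card N \<le> card M)"

definition matching_number :: "'a graph \<Rightarrow> nat" where
  "matching_number G = Max (card ` {M. matching G M})"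

definition transversal_set :: "int \<Rightarrow> 'a graph \<Rightarrow> 'a set set \<Rightarrow> bool" where
  "transversal_set d G T \<longleftrightarrow>
     1 \<le> d \<and> d \<le> int (matching_number G) \<and>
     T \<subseteq> edges G \<and> (\<forall>M. maximum_matching G M \<longrightarrow> int (card (T \<inter> M)) \<ge> d)"

(* The minimum is over a nonempty set exactly when 1 <= d <= matching_number G
   (for such d the full edge set is a transversal set); for any other d the
   value is unspecified. *)
definition transversal_number :: "int \<Rightarrow> 'a graph \<Rightarrow> nat" where
  "transversal_number d G = Min (card ` {T. transversal_set d G T})"

definition path_graph :: "nat \<Rightarrow> nat graph" where
  "path_graph m = \<lparr>verts = {..<m}, edges = {{i, Suc i} | i. Suc i < m}\<rparr>"

(* Meaningful only for n >= 3: for n = 1 the formula for the edges yields a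
   singleton, for n = 2 a single edge. *)
definition cycle_graph :: "nat \<Rightarrow> nat graph" where
  "cycle_graph n = \<lparr>verts = {..<n}, edges = {{i, Suc i mod n} | i. i < n}\<rparr>"

definition cartesian_product :: "'a graph \<Rightarrow> 'b graph \<Rightarrow> ('a \<times> 'b) graph"  (infixr "\<box>" 70) where
  "G \<box> H = \<lparr>verts = verts G \<times> verts H,
     edges = {{(g1, h1), (g2, h2)} | g1 h1 g2 h2.
       (g1, h1) \<in> verts G \<times> verts H \<and> (g2, h2) \<in> verts G \<times> verts H \<and>
       (g1 = g2 \<and> {h1, h2} \<in> edges H \<or> {g1, g2} \<in> edges G \<and> h1 = h2)}\<rparr>"

lemma simple_graph_path: "simple_graph (path_graph m)"
  by (auto simp: simple_graph_def path_graph_def)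

lemma simple_graph_cycle:
  assumes "n \<ge> 3"
  shows "simple_graph (cycle_graph n)"
proof -
  have "i \<noteq> Suc i mod n" if "i < n" for i
    using assms that by (cases "Suc i = n") auto
  then show ?thesis
    using assms by (auto simp: simple_graph_def cycle_graph_def)
qed

lemma simple_graph_cartesian_product:
  assumes "simple_graph G" "simple_graph H"
  shows "simple_graph (G \<box> H)"
proof -
  have "g1 \<noteq> g2" if "{g1, g2} \<in> edges G" for g1 g2
    using assms(1) that by (force simp: simple_graph_def)
  moreover have "h1 \<noteq> h2" if "{h1, h2} \<in> edges H" for h1 h2
    using assms(2) that by (force simp: simple_graph_def)
  ultimately have "e \<subseteq> verts (G \<box> H) \<and> card e = 2" if "e \<in> edges (G \<box> H)" for e
    using that unfolding cartesian_product_def by auto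
  moreover have "finite (verts (G \<box> H))"
    using assms by (simp add: simple_graph_def cartesian_product_def)
  ultimately show ?thesis
    by (simp add: simple_graph_def)
qed

lemma path_1_cartesian_product_cycle:
  assumes "n \<ge> 3"
  shows "verts (path_graph 1 \<box> cycle_graph n) = Pair 0 ` verts (cycle_graph n)"
    and "edges (path_graph 1 \<box> cycle_graph n) = image (Pair 0) ` edges (cycle_graph n)"
proof -
  show "verts (path_graph 1 \<box> cycle_graph n) = Pair 0 ` verts (cycle_graph n)"
    by (auto simp: cartesian_product_def path_graph_def)
  have edge: "\<exists>x y. e = {x, y} \<and> x \<in> verts (cycle_graph n) \<and> y \<in> verts (cycle_graph n)"
    if e: "e \<in> edges (cycle_graph n)" for e
  proof -
    obtain i where "i < n" "e = {i, Suc i mod n}"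
      using e unfolding cycle_graph_def by auto
    then have "e = {i, Suc i mod n} \<and> i \<in> verts (cycle_graph n) \<and> Suc i mod n \<in> verts (cycle_graph n)"
      unfolding cycle_graph_def by simp
    then show ?thesis by blast
  qed
  show "edges (path_graph 1 \<box> cycle_graph n) = image (Pair 0) ` edges (cycle_graph n)" (is "?L = ?R")
  proof
    show "?L \<subseteq> ?R"
    proof
      fix e assume "e \<in> ?L"
      then obtain x y where "e = {(0, x), (0, y)}" "{x, y} \<in> edges (cycle_graph n)"
        unfolding cartesian_product_def path_graph_def by auto
      then show "e \<in> ?R"
        by (intro image_eqI[where x = "{x, y}"]) simp_all
    qed
    show "?R \<subseteq> ?L"
    proof
      fix e assume "e \<in> ?R"
      then obtain f where f: "e = Pair 0 ` f" "f \<in> edges (cycle_graph n)"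
        by (elim imageE)
      then obtain x y where "f = {x, y}" "x \<in> verts (cycle_graph n)" "y \<in> verts (cycle_graph n)"
        using edge by meson
      then show "e \<in> ?L"
        using f unfolding cartesian_product_def path_graph_def
        by (simp, intro exI[where x = x] exI[where x = y]) simp
    qed
  qed
qed

end

theory Submission
  imports Defs
begin

text \<open>
  All graphs involved have an odd number \<open>2 * \<nu> + 1\<close> of vertices and possess a matching missing just one
  vertex, so the maximum matchings are those that miss exactly one vertex. Every bound of the theorem
  comes from one of four simple principles for such graphs.

  Lower bounds come from explicit families of maximum matchings: a family of \<open>r\<close> pairwise disjoint ones
  forces at least \<open>r * d\<close> edges into a \<open>d\<close>-transversal
  (\<open>disjoint_maximum_matchings_bound\<close>). A family of \<open>r\<close> that covers all edges bounds the complement of a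
  \<open>d\<close>-transversal by \<open>r * (\<nu> - d)\<close>, because the complement has at most \<open>\<nu> - d\<close> edges in each of them
  (\<open>covering_maximum_matchings_bound\<close>). On the cylinder there are three disjoint maximum matchings
  (\<open>colour_mates_disjoint\<close>), giving \<open>3 * d\<close>, and four covering all \<open>2 * m * n - n\<close> edges
  (\<open>cover_mate_covers\<close>), giving \<open>4 * d - n + 2\<close>. On an odd cycle, two disjoint ones that both avoid
  a chosen edge of the transversal give \<open>2 * d + 1\<close>.

  Upper bounds come from explicit transversals. All edges meeting a set of \<open>2 * d\<close> vertices form a
  \<open>d\<close>-transversal, since a maximum matching covers at least \<open>2 * d - 1\<close> of these vertices
  (\<open>transversal_number_le_edges_meeting\<close>); for an initial segment in lexicographic order there are at most
  \<open>4 * d + 1\<close> such edges on the cylinder and \<open>2 * d + 1\<close> on the cycle. All edges avoiding an independent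
  set of \<open>\<nu> - d\<close> vertices also form a \<open>d\<close>-transversal (\<open>transversal_number_le_independent\<close>), and it is
  small when the degrees of these vertices are large. A checkerboard pattern on all columns but one supplies
  \<open>(n - 1) / 2\<close> independent vertices per row. The inner rows, with degree 4, suffice exactly when
  \<open>d \<ge> (m - 3) / 2 + n\<close>, and then \<open>4 * d - n + 2\<close> edges remain; for smaller \<open>d\<close>, down to \<open>(m - 1) / 2\<close>, the
  two boundary rows, with degree 3, supply the rest, and \<open>3 * d + (m + 1) / 2\<close> edges remain.
\<close>

section \<open>Transversals of graphs with near-perfect matchings\<close>

text \<open>A matching that misses the single vertex \<open>x\<close> is encoded by the involution that sends each matched
vertex to its partner and fixes \<open>x\<close>. With this encoding, matching, covering and disjointness
become pointwise statements about functions, which case distinctions settle.\<close>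

definition near_perfect_mate :: "'a graph \<Rightarrow> ('a \<Rightarrow> 'a) \<Rightarrow> 'a \<Rightarrow> bool" where
  "near_perfect_mate G f x \<longleftrightarrow> x \<in> verts G \<and> f x = x \<and>
     (\<forall>v\<in>verts G. f v \<in> verts G \<and> f (f v) = v \<and> (v \<noteq> x \<longrightarrow> {v, f v} \<in> edges G))"

definition mate_edges :: "'a graph \<Rightarrow> ('a \<Rightarrow> 'a) \<Rightarrow> 'a set set" where
  "mate_edges G f = {{v, f v} | v. v \<in> verts G \<and> f v \<noteq> v}"

lemma mate_edgesI:
  assumes "v \<in> verts G" "f v = w" "v \<noteq> w"
  shows "{v, w} \<in> mate_edges G f"
  unfolding mate_edges_def using assms by (intro CollectI exI[of _ v]) auto

lemma finite_edges:
  assumes "simple_graph G"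
  shows "finite (edges G)"
proof (rule finite_subset)
  show "edges G \<subseteq> Pow (verts G)" using assms by (auto simp: simple_graph_def)
qed (use assms in \<open>simp add: simple_graph_def\<close>)

lemma finite_matching:
  assumes "simple_graph G" "matching G M"
  shows "finite M"
  using assms finite_edges finite_subset unfolding matching_def by blast

lemma card_Union_matching:
  assumes "simple_graph G" "matching G M"
  shows "card (\<Union>M) = 2 * card M"
proof -
  have two: "card e = 2" if "e \<in> M" for e
    using assms that by (auto simp: simple_graph_def matching_def)
  have "card (\<Union>M) = (\<Sum>e\<in>M. card e)"
  proof (rule card_Union_disjoint)
    show "pairwise disjnt M" using assms(2) by (auto simp: matching_def pairwise_def disjnt_def)
    show "finite e" if "e \<in> M" for e using two[OF that] by (simp add: card_ge_0_finite)
  qed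
  also have "\<dots> = 2 * card M" using two by simp
  finally show ?thesis .
qed

lemma matching_subset_verts:
  assumes "simple_graph G" "matching G M"
  shows "\<Union>M \<subseteq> verts G"
  using assms by (auto simp: simple_graph_def matching_def)

lemma matching_mate_edges:
  assumes G: "simple_graph G" and f: "near_perfect_mate G f x"
  shows "matching G (mate_edges G f)" and "\<Union>(mate_edges G f) = verts G - {x}"
proof -
  have ne: "f v \<noteq> v" if "v \<in> verts G" "v \<noteq> x" for v
  proof
    assume "f v = v"
    then have "{v} \<in> edges G" using f that by (force simp: near_perfect_mate_def)
    then show False using G by (force simp: simple_graph_def)
  qed
  show "matching G (mate_edges G f)"
    unfolding matching_def
  proof (intro conjI ballI impI)
    show "mate_edges G f \<subseteq> edges G"
      using f by (auto simp: mate_edges_def near_perfect_mate_def)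
    fix d e assume "d \<in> mate_edges G f" "e \<in> mate_edges G f" "d \<noteq> e"
    then obtain u v where "d = {u, f u}" "e = {v, f v}" "u \<in> verts G" "v \<in> verts G"
      by (auto simp: mate_edges_def)
    moreover have "f (f u) = u" "f (f v) = v"
      using f calculation by (auto simp: near_perfect_mate_def)
    ultimately show "d \<inter> e = {}"
      using \<open>d \<noteq> e\<close> by (metis disjoint_iff doubleton_eq_iff insertE singletonD)
  qed
  show "\<Union>(mate_edges G f) = verts G - {x}"
  proof
    show "\<Union>(mate_edges G f) \<subseteq> verts G - {x}"
      using f by (auto simp: mate_edges_def near_perfect_mate_def)
    show "verts G - {x} \<subseteq> \<Union>(mate_edges G f)"
      using ne by (auto simp: mate_edges_def)
  qed
qed

text \<open>All graphs of the theorem have an odd number of vertices and a matching that misses only one of them.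
Hence their maximum matchings are exactly the near-perfect ones, all of the same size \<open>\<nu>\<close>;
this is the only property of maximum matchings on which the general bounds rest.\<close>

locale odd_near_perfect =
  fixes G :: "'a graph" and \<nu> :: nat
  assumes simple: "simple_graph G"
    and card_verts: "card (verts G) = 2 * \<nu> + 1"
    and ex_mate: "\<exists>f x. near_perfect_mate G f x"
begin

lemma finite_verts: "finite (verts G)"
  using simple by (simp add: simple_graph_def)

lemma card_matching_le:
  assumes "matching G M"
  shows "card M \<le> \<nu>"
proof -
  have "2 * card M \<le> card (verts G)"
    using card_mono[OF finite_verts matching_subset_verts[OF simple assms]]
    by (simp add: card_Union_matching[OF simple assms])
  then show ?thesis by (simp add: card_verts)
qed

lemma card_mate_edges:
  assumes "near_perfect_mate G f x"
  shows "card (mate_edges G f) = \<nu>"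
proof -
  have "2 * card (mate_edges G f) = card (verts G - {x})"
    using card_Union_matching[OF simple] matching_mate_edges[OF simple assms] by metis
  also have "\<dots> = 2 * \<nu>"
    using assms by (simp add: card_verts near_perfect_mate_def)
  finally show ?thesis by simp
qed

lemma maximum_mate_edges:
  assumes "near_perfect_mate G f x"
  shows "maximum_matching G (mate_edges G f)"
  using matching_mate_edges(1)[OF simple assms] card_mate_edges[OF assms] card_matching_le
  by (simp add: maximum_matching_def)

lemma card_maximum_matching:
  assumes "maximum_matching G M"
  shows "card M = \<nu>"
proof -
  obtain f x where "near_perfect_mate G f x" using ex_mate by blast
  then have "\<nu> \<le> card M"
    using assms matching_mate_edges(1)[OF simple] card_mate_edges
    unfolding maximum_matching_def by metis
  moreover have "card M \<le> \<nu>" using assms card_matching_le by (simp add: maximum_matching_def)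
  ultimately show ?thesis by simp
qed

lemma matching_number: "matching_number G = \<nu>"
proof -
  obtain f x where f: "near_perfect_mate G f x" using ex_mate by blast
  have "{M. matching G M} \<subseteq> Pow (edges G)" by (auto simp: matching_def)
  then have "finite (card ` {M. matching G M})"
    using finite_edges[OF simple] by (meson finite_Pow_iff finite_imageI finite_subset)
  moreover have "\<nu> \<in> card ` {M. matching G M}"
    using card_mate_edges[OF f] matching_mate_edges(1)[OF simple f] by force
  ultimately show ?thesis
    unfolding matching_number_def using card_matching_le by (intro Max_eqI) auto
qed

lemma finite_transversal_cards: "finite (card ` {T. transversal_set d G T})"
proof -
  have "{T. transversal_set d G T} \<subseteq> Pow (edges G)" by (auto simp: transversal_set_def)
  then show ?thesis
    using finite_edges[OF simple] by (meson finite_Pow_iff finite_imageI finite_subset)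
qed

lemma transversal_number_le:
  assumes "1 \<le> d" "d \<le> \<nu>" "T \<subseteq> edges G"
    and "\<And>M. maximum_matching G M \<Longrightarrow> d \<le> card (T \<inter> M)"
  shows "transversal_number (int d) G \<le> card T"
proof -
  have "transversal_set (int d) G T"
    using assms by (simp add: transversal_set_def matching_number)
  then show ?thesis
    unfolding transversal_number_def using finite_transversal_cards by (intro Min_le) auto
qed

lemma transversal_number_attained:
  assumes "1 \<le> d" "d \<le> \<nu>"
  obtains T where "T \<subseteq> edges G" "\<And>M. maximum_matching G M \<Longrightarrow> d \<le> card (T \<inter> M)"
    "card T = transversal_number (int d) G"
proof -
  have "transversal_set (int d) G (edges G)"
    unfolding transversal_set_def
  proof (intro conjI allI impI)
    fix M assume M: "maximum_matching G M"
    then have "edges G \<inter> M = M" by (auto simp: maximum_matching_def matching_def)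
    then show "int d \<le> int (card (edges G \<inter> M))"
      using card_maximum_matching[OF M] assms by simp
  qed (use assms matching_number in auto)
  then have "card ` {T. transversal_set (int d) G T} \<noteq> {}" by auto
  from Min_in[OF finite_transversal_cards this]
  obtain T where "transversal_set (int d) G T" "card T = transversal_number (int d) G"
    unfolding transversal_number_def by auto
  then show ?thesis using that unfolding transversal_set_def by auto
qed

text \<open>A transversal spends \<open>d\<close> edges on each of the matchings, and on disjoint ones it spends different
edges. Intersecting with the union on the right keeps track of edges of \<open>T\<close> that no matching of the
family uses, which yields the extra edge for odd cycles.\<close>

lemma disjoint_maximum_matchings_bound:
  assumes "finite K" and M: "\<And>k. k \<in> K \<Longrightarrow> maximum_matching G (M k)"
    and disj: "\<And>k l. k \<in> K \<Longrightarrow> l \<in> K \<Longrightarrow> k \<noteq> l \<Longrightarrow> M k \<inter> M l = {}"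
    and T: "\<And>M. maximum_matching G M \<Longrightarrow> d \<le> card (T \<inter> M)"
  shows "card K * d \<le> card (T \<inter> (\<Union>k\<in>K. M k))"
proof -
  have fin: "finite (M k)" if "k \<in> K" for k
    using M[OF that] finite_matching[OF simple] by (simp add: maximum_matching_def)
  have "card K * d \<le> (\<Sum>k\<in>K. card (T \<inter> M k))"
    using sum_bounded_below[of K d "\<lambda>k. card (T \<inter> M k)"] T M by simp
  also have "\<dots> = card (\<Union>k\<in>K. T \<inter> M k)"
    using disj fin \<open>finite K\<close> by (intro card_UN_disjoint[symmetric]) auto
  finally show ?thesis by simp
qed

text \<open>The complement of a transversal contains at most \<open>\<nu> - d\<close> edges of each maximum matching, so it is small
when few maximum matchings exhaust the edge set.\<close>

lemma covering_maximum_matchings_bound: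
  assumes "finite K" and M: "\<And>k. k \<in> K \<Longrightarrow> maximum_matching G (M k)"
    and cover: "edges G \<subseteq> (\<Union>k\<in>K. M k)"
    and T: "\<And>M. maximum_matching G M \<Longrightarrow> d \<le> card (T \<inter> M)"
    and "T \<subseteq> edges G" "d \<le> \<nu>"
  shows "card (edges G) \<le> card T + card K * (\<nu> - d)"
proof -
  have fin: "finite (M k)" if "k \<in> K" for k
    using M[OF that] finite_matching[OF simple] by (simp add: maximum_matching_def)
  have diff: "card (M k - T) \<le> \<nu> - d" if "k \<in> K" for k
  proof -
    have "card (M k - T) = card (M k) - card (T \<inter> M k)"
      using card_Diff_subset_Int[of "M k" T] fin[OF that] by (simp add: Int_commute)
    then show ?thesis
      using card_maximum_matching[OF M[OF that]] T[OF M[OF that]] by simp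
  qed
  have "card (edges G - T) \<le> card (\<Union>k\<in>K. M k - T)"
    using cover fin \<open>finite K\<close> by (intro card_mono) auto
  also have "\<dots> \<le> (\<Sum>k\<in>K. card (M k - T))" by (rule card_UN_le[OF \<open>finite K\<close>])
  also have "\<dots> \<le> card K * (\<nu> - d)" using sum_bounded_above[of K "\<lambda>k. card (M k - T)"] diff by simp
  finally have "card (edges G - T) \<le> card K * (\<nu> - d)" .
  moreover have "card (edges G) = card (edges G - T) + card T"
    using finite_edges[OF simple] \<open>T \<subseteq> edges G\<close>
    by (metis card_Diff_subset card_mono finite_subset le_add_diff_inverse2)
  ultimately show ?thesis by simp
qed

text \<open>A maximum matching covers at least \<open>2 * d - 1\<close> vertices of \<open>A\<close>, and each edge covers at most two of
them, so at least \<open>d\<close> of its edges meet \<open>A\<close>.\<close>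

lemma transversal_number_le_edges_meeting:
  assumes "1 \<le> d" "d \<le> \<nu>" "A \<subseteq> verts G" "card A = 2 * d"
  shows "transversal_number (int d) G \<le> card {e \<in> edges G. e \<inter> A \<noteq> {}}"
proof (rule transversal_number_le[OF assms(1,2)])
  let ?T = "{e \<in> edges G. e \<inter> A \<noteq> {}}"
  show "?T \<subseteq> edges G" by auto
  fix M assume M: "maximum_matching G M"
  then have mat: "matching G M" by (simp add: maximum_matching_def)
  have sub: "matching G (?T \<inter> M)" using mat by (auto simp: matching_def)
  have finA: "finite A" using assms(3) finite_verts finite_subset by blast
  have "card (verts G - \<Union>M) = 1"
    using card_Diff_subset[OF _ matching_subset_verts[OF simple mat]]
      finite_subset[OF matching_subset_verts[OF simple mat] finite_verts]
      card_Union_matching[OF simple mat] card_maximum_matching[OF M] card_verts by simp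
  then have "card (A - \<Union>M) \<le> 1"
    using card_mono[of "verts G - \<Union>M" "A - \<Union>M"] assms(3) finite_verts by auto
  moreover have "A \<subseteq> (A - \<Union>M) \<union> \<Union>(?T \<inter> M)"
    using mat by (auto simp: matching_def)
  then have "card A \<le> card (A - \<Union>M) + card (\<Union>(?T \<inter> M))"
    using finA finite_subset[OF matching_subset_verts[OF simple sub] finite_verts]
    by (meson card_Un_le card_mono finite_Diff finite_UnI order_trans)
  ultimately show "d \<le> card (?T \<inter> M)"
    using card_Union_matching[OF simple sub] assms(4) by linarith
qed

text \<open>The transversal here consists of the edges that avoid \<open>I\<close>: a matching has at most one edge at
each vertex of \<open>I\<close>, hence at least \<open>\<nu> - card I\<close> edges elsewhere. Independence of \<open>I\<close> makes the
number of discarded edges as large as possible, namely the sum of the degrees.\<close>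

lemma transversal_number_le_independent:
  assumes "1 \<le> d" "d + card I = \<nu>" "I \<subseteq> verts G"
    and indep: "\<And>u v. u \<in> I \<Longrightarrow> v \<in> I \<Longrightarrow> {u, v} \<notin> edges G"
  shows "transversal_number (int d) G + (\<Sum>v\<in>I. card {e \<in> edges G. v \<in> e}) \<le> card (edges G)"
proof -
  let ?S = "{e \<in> edges G. e \<inter> I \<noteq> {}}"
  have finI: "finite I" using assms(3) finite_verts finite_subset by blast
  have finE: "finite (edges G)" by (rule finite_edges[OF simple])
  have "transversal_number (int d) G \<le> card (edges G - ?S)"
  proof (rule transversal_number_le)
    fix M assume M: "maximum_matching G M"
    then have mat: "matching G M" by (simp add: maximum_matching_def)
    have finM: "finite M" by (rule finite_matching[OF simple mat])
    define g where "g e = (SOME v. v \<in> e \<inter> I)" for e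
    have g: "g e \<in> e \<inter> I" if "e \<in> M \<inter> ?S" for e
      unfolding g_def by (rule someI_ex) (use that in auto)
    have "inj_on g (M \<inter> ?S)"
    proof (rule inj_onI)
      fix e f assume ef: "e \<in> M \<inter> ?S" "f \<in> M \<inter> ?S" "g e = g f"
      then have "g e \<in> e \<inter> f" using g[OF ef(1)] g[OF ef(2)] by simp
      moreover have "e \<in> M" "f \<in> M" using ef by auto
      ultimately show "e = f" using mat unfolding matching_def by blast
    qed
    then have "card (M \<inter> ?S) \<le> card I" using g finI by (intro card_inj_on_le[of g]) auto
    moreover have "(edges G - ?S) \<inter> M = M - M \<inter> ?S" using mat by (auto simp: matching_def)
    then have "card ((edges G - ?S) \<inter> M) = card M - card (M \<inter> ?S)"
      using finM by (simp add: card_Diff_subset)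
    ultimately show "d \<le> card ((edges G - ?S) \<inter> M)"
      using card_maximum_matching[OF M] assms(2) by linarith
  qed (use assms in auto)
  moreover have "card ?S = (\<Sum>v\<in>I. card {e \<in> edges G. v \<in> e})"
  proof -
    have "card (\<Union>v\<in>I. {e \<in> edges G. v \<in> e}) = (\<Sum>v\<in>I. card {e \<in> edges G. v \<in> e})"
    proof (rule card_UN_disjoint[OF finI])
      show "\<forall>u\<in>I. \<forall>v\<in>I. u \<noteq> v \<longrightarrow> {e \<in> edges G. u \<in> e} \<inter> {e \<in> edges G. v \<in> e} = {}"
      proof (intro ballI impI)
        fix u v assume uv: "u \<in> I" "v \<in> I" "u \<noteq> v"
        have False if "e \<in> edges G" "u \<in> e" "v \<in> e" for e
        proof -
          have "card e = 2" using simple that by (auto simp: simple_graph_def)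
          then have "e = {u, v}" using that uv by (auto simp: card_2_iff)
          then show False using indep[OF uv(1,2)] that by simp
        qed
        then show "{e \<in> edges G. u \<in> e} \<inter> {e \<in> edges G. v \<in> e} = {}" by auto
      qed
    qed (use finE in auto)
    moreover have "(\<Union>v\<in>I. {e \<in> edges G. v \<in> e}) = ?S" by auto
    ultimately show ?thesis by simp
  qed
  moreover have "card (edges G - ?S) + card ?S = card (edges G)"
    using finE by (metis (no_types, lifting) card_Diff_subset card_mono finite_subset
        le_add_diff_inverse2 mem_Collect_eq subsetI)
  ultimately show ?thesis by linarith
qed

end

text \<open>If the two matchings shared the edge \<open>{u, f u} = {v, g v}\<close>, then \<open>g\<close>, being an involution, would
send \<open>u\<close> to \<open>f u\<close> whichever end of the edge \<open>v\<close> is.\<close>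

lemma mate_edges_disjoint:
  assumes "near_perfect_mate G f x" "near_perfect_mate G g y"
    and "\<And>v. v \<in> verts G \<Longrightarrow> f v \<noteq> v \<Longrightarrow> f v \<noteq> g v"
  shows "mate_edges G f \<inter> mate_edges G g = {}"
proof -
  have False if e: "e \<in> mate_edges G f" "e \<in> mate_edges G g" for e
  proof -
    obtain u where "u \<in> verts G" "f u \<noteq> u" "e = {u, f u}"
      using e(1) unfolding mate_edges_def by blast
    moreover obtain v where "v \<in> verts G" "e = {v, g v}"
      using e(2) unfolding mate_edges_def by blast
    moreover from this have "g (g v) = v" using assms(2) by (auto simp: near_perfect_mate_def)
    ultimately have "f u = g u" by (auto simp: doubleton_eq_iff)
    then show False using assms(3) \<open>u \<in> verts G\<close> \<open>f u \<noteq> u\<close> by blast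
  qed
  then show ?thesis by blast
qed

section \<open>Mates on paths and cycles\<close>

text \<open>For even \<open>x\<close>, the vertices before \<open>x\<close> are paired as \<open>{0, 1}, {2, 3}, ...\<close> and those after \<open>x\<close> as
\<open>{x + 1, x + 2}, {x + 3, x + 4}, ...\<close>; on an odd path this leaves only \<open>x\<close> unmatched.\<close>

definition path_mate :: "nat \<Rightarrow> nat \<Rightarrow> nat" where
  "path_mate x j = (if j = x then x else if even j = (j < x) then Suc j else j - 1)"

text \<open>For odd \<open>x\<close> there is an odd number of vertices on each side of \<open>x\<close>, so the edge \<open>{n - 1, 0}\<close> joining
the two ends is used as well, and the pairs are the shifted ones.\<close>

definition cycle_mate :: "nat \<Rightarrow> nat \<Rightarrow> nat \<Rightarrow> nat" where
  "cycle_mate n x j =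
    (if even x then path_mate x j
     else if j = 0 then n - 1 else if j = n - 1 then 0
     else if j = x then x
     else if even j = (j < x) then j - 1 else Suc j)"

lemma edges_path_graph_iff:
  "{i, j} \<in> edges (path_graph m) \<longleftrightarrow> (j = Suc i \<and> j < m) \<or> (i = Suc j \<and> i < m)"
  by (auto simp: path_graph_def doubleton_eq_iff)

lemma edges_cycle_graph_iff:
  assumes "n \<ge> 3"
  shows "{i, j} \<in> edges (cycle_graph n) \<longleftrightarrow>
    (j = Suc i \<and> j < n) \<or> (i = Suc j \<and> i < n) \<or> (i = 0 \<and> j = n - 1) \<or> (j = 0 \<and> i = n - 1)"
proof -
  have last: "Suc (n - 1) mod n = 0" using assms by simp
  have edge: "{i, j} \<in> edges (cycle_graph n) \<longleftrightarrow> (\<exists>k<n. {i, j} = {k, Suc k mod n})" for i j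
    by (auto simp: cycle_graph_def)
  have up: "{k, Suc k} \<in> edges (cycle_graph n)" if "Suc k < n" for k
    unfolding edge using that by (intro exI[of _ k]) auto
  have wrap: "{n - 1, 0} \<in> edges (cycle_graph n)"
    unfolding edge using last assms by (intro exI[of _ "n - 1"]) auto
  show ?thesis (is "_ \<longleftrightarrow> ?R")
  proof
    assume "{i, j} \<in> edges (cycle_graph n)"
    then obtain k where k: "k < n" "{i, j} = {k, Suc k mod n}" unfolding edge by blast
    show ?R
    proof (cases "k = n - 1")
      case True
      then have "{i, j} = {n - 1, 0}" using k last by simp
      then show ?thesis by (auto simp: doubleton_eq_iff)
    next
      case False
      then have "{i, j} = {k, Suc k}" "Suc k < n" using k by auto
      then show ?thesis by (auto simp: doubleton_eq_iff)
    qed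
  next
    assume ?R
    then show "{i, j} \<in> edges (cycle_graph n)"
      using up[of i] up[of j] wrap by (auto simp: insert_commute)
  qed
qed

lemma verts_path_cycle [simp]: "verts (path_graph m) = {..<m}" "verts (cycle_graph n) = {..<n}"
  by (simp_all add: path_graph_def cycle_graph_def)

lemma path_mate_near_perfect:
  assumes "odd m" "even x" "x < m"
  shows "near_perfect_mate (path_graph m) (path_mate x) x"
proof -
  obtain p y where "m = 2 * p + 1" "x = 2 * y"
    using assms by (auto elim!: oddE evenE)
  then have "path_mate x j < m \<and> path_mate x (path_mate x j) = j \<and>
      (j \<noteq> x \<longrightarrow> {j, path_mate x j} \<in> edges (path_graph m))" if "j < m" for j
    unfolding edges_path_graph_iff path_mate_def using assms(3) that
    by (cases "even j"; auto elim!: oddE evenE; presburger)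
  then show ?thesis using assms(3) by (simp add: near_perfect_mate_def path_mate_def)
qed

lemma cycle_mate_near_perfect:
  assumes "odd n" "n \<ge> 3" "x < n"
  shows "near_perfect_mate (cycle_graph n) (cycle_mate n x) x"
proof (cases "even x")
  case True
  have "cycle_mate n x = path_mate x" using True by (simp add: cycle_mate_def fun_eq_iff)
  then show ?thesis
    using path_mate_near_perfect[OF assms(1) True assms(3)] assms(2)
    by (auto simp: near_perfect_mate_def edges_path_graph_iff edges_cycle_graph_iff)
next
  case False
  obtain q y where qy: "n = 2 * q + 1" "x = 2 * y + 1"
    using assms False by (auto elim!: oddE)
  have "cycle_mate n x j < n \<and> cycle_mate n x (cycle_mate n x j) = j \<and>
      (j \<noteq> x \<longrightarrow> {j, cycle_mate n x j} \<in> edges (cycle_graph n))" if "j < n" for j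
  proof (cases "even j")
    case True
    then obtain k where "j = 2 * k" by (auto elim!: evenE)
    then show ?thesis
      unfolding edges_cycle_graph_iff[OF assms(2)] cycle_mate_def using assms(2,3) that qy
      by auto
  next
    case False
    then obtain k where "j = 2 * k + 1" by (auto elim!: oddE)
    then show ?thesis
      unfolding edges_cycle_graph_iff[OF assms(2)] cycle_mate_def using assms(2,3) that qy
      by auto
  qed
  moreover have "cycle_mate n x x = x" using qy assms(3) by (auto simp: cycle_mate_def)
  ultimately show ?thesis using assms(3) by (simp add: near_perfect_mate_def)
qed

section \<open>Odd cycles\<close>

lemma odd_near_perfect_cycle:
  assumes "odd n" "n \<ge> 3"
  shows "odd_near_perfect (cycle_graph n) ((n - 1) div 2)"
proof
  show "simple_graph (cycle_graph n)" by (rule simple_graph_cycle[OF assms(2)])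
  show "card (verts (cycle_graph n)) = 2 * ((n - 1) div 2) + 1"
    using assms by (auto elim!: oddE)
  show "\<exists>f x. near_perfect_mate (cycle_graph n) f x"
    using cycle_mate_near_perfect[OF assms, of 0] assms by auto
qed

lemma cycle_edges_cases:
  assumes "e \<in> edges (cycle_graph n)"
  obtains i where "i < n" "e = {i, Suc i mod n}"
  using assms by (auto simp: cycle_graph_def)

text \<open>The odd cycle with the edge \<open>{c, c + 1}\<close> deleted is a path with an even number of edges, and its edges
alternate between the two matchings missing \<open>c\<close> and \<open>c + 1\<close>.\<close>

lemma cycle_two_matchings_disjoint:
  assumes "odd n" "n \<ge> 3" "c < n" "j < n" "cycle_mate n c j \<noteq> j"
  shows "cycle_mate n c j \<noteq> cycle_mate n (Suc c mod n) j"
proof -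
  obtain q where q: "n = 2 * q + 1" using assms by (auto elim!: oddE)
  show ?thesis
  proof (cases "Suc c = n")
    case True
    then show ?thesis using assms q by (cases "even j") (auto simp: cycle_mate_def path_mate_def split: if_splits)
  next
    case False
    then have "Suc c mod n = Suc c" "Suc c < n" using assms by auto
    then show ?thesis using assms(2-5) q
      apply (cases "even c"; cases "even j")
      apply (auto simp: cycle_mate_def path_mate_def elim!: oddE evenE split: if_splits)
      subgoal by presburger
      done
  qed
qed

text \<open>Two disjoint maximum matchings give \<open>2 * d\<close> edges of a transversal \<open>T\<close>. As both can avoid any prescribed
edge of the cycle, one prescribes an edge of \<open>T\<close> and gains one more.\<close>

lemma transversal_number_cycle_lower:
  assumes n: "odd n" "n \<ge> 3" and d: "1 \<le> d" "d \<le> (n - 1) div 2"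
  shows "2 * d + 1 \<le> transversal_number (int d) (cycle_graph n)"
proof -
  let ?G = "cycle_graph n"
  interpret odd_near_perfect ?G "(n - 1) div 2" by (rule odd_near_perfect_cycle[OF n])
  obtain T where T: "T \<subseteq> edges ?G" "\<And>M. maximum_matching ?G M \<Longrightarrow> d \<le> card (T \<inter> M)"
      "card T = transversal_number (int d) ?G"
    using transversal_number_attained[OF d] by blast
  have finT: "finite T" using T(1) finite_edges[OF simple] finite_subset by blast
  obtain f x where "near_perfect_mate ?G f x" using ex_mate by blast
  \<comment> \<open>Since \<open>d\<close> is positive, \<open>T\<close> contains an edge, around which the two matchings are placed.\<close>
  from T(2)[OF maximum_mate_edges[OF this]] have "T \<noteq> {}" using d by auto
  then obtain e where e: "e \<in> T" by blast
  then obtain c where c: "c < n" "e = {c, Suc c mod n}"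
    using cycle_edges_cases[OF subsetD[OF T(1) e]] by blast
  let ?c = "\<lambda>k. if k then c else Suc c mod n"
  let ?M = "\<lambda>k. mate_edges ?G (cycle_mate n (?c k))"
  have np: "near_perfect_mate ?G (cycle_mate n (?c k)) (?c k)" for k
    by (rule cycle_mate_near_perfect[OF n]) (use c in auto)
  have "mate_edges ?G (cycle_mate n c) \<inter> mate_edges ?G (cycle_mate n (Suc c mod n)) = {}"
    using np[of True] np[of False] cycle_two_matchings_disjoint[OF n c(1)]
    by (intro mate_edges_disjoint) auto
  then have disj: "?M k \<inter> ?M l = {}" if "k \<noteq> l" for k l using that by (auto simp: Int_commute)
  have "card (UNIV :: bool set) * d \<le> card (T \<inter> (\<Union>k\<in>UNIV. ?M k))"
    using maximum_mate_edges[OF np] disj T(2)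
    by (intro disjoint_maximum_matchings_bound) auto
  moreover have "e \<notin> ?M k" for k
  proof -
    have "?c k \<notin> \<Union>(?M k)" using matching_mate_edges(2)[OF simple np, of k] by simp
    moreover have "?c k \<in> e" using c(2) by simp
    ultimately show ?thesis by blast
  qed
  then have "T \<inter> (\<Union>k\<in>UNIV. ?M k) \<subseteq> T - {e}" by auto
  then have "card (T \<inter> (\<Union>k\<in>UNIV. ?M k)) \<le> card T - 1"
    using card_mono[of "T - {e}"] finT e by fastforce
  moreover have "card T > 0" using e finT by (auto simp: card_gt_0_iff)
  ultimately show ?thesis using T(3) by simp
qed

text \<open>The transversal consists of the edges meeting \<open>2 * d\<close> consecutive vertices.\<close>

lemma transversal_number_cycle_upper:
  assumes n: "odd n" "n \<ge> 3" and d: "1 \<le> d" "d \<le> (n - 1) div 2"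
  shows "transversal_number (int d) (cycle_graph n) \<le> 2 * d + 1"
proof -
  let ?G = "cycle_graph n"
  interpret odd_near_perfect ?G "(n - 1) div 2" by (rule odd_near_perfect_cycle[OF n])
  have "transversal_number (int d) ?G \<le> card {e \<in> edges ?G. e \<inter> {..<2 * d} \<noteq> {}}"
    using d by (intro transversal_number_le_edges_meeting) auto
  also have "{e \<in> edges ?G. e \<inter> {..<2 * d} \<noteq> {}} \<subseteq>
      insert {n - 1, 0} ((\<lambda>i. {i, Suc i mod n}) ` {..<2 * d})"
  proof
    fix e assume e: "e \<in> {e \<in> edges ?G. e \<inter> {..<2 * d} \<noteq> {}}"
    then obtain i where i: "i < n" "e = {i, Suc i mod n}" by (auto elim: cycle_edges_cases)
    show "e \<in> insert {n - 1, 0} ((\<lambda>i. {i, Suc i mod n}) ` {..<2 * d})"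
    proof (cases "Suc i = n")
      case True
      then show ?thesis using i by (auto simp: insert_commute)
    next
      case False
      then have "i < 2 * d" using e i by auto
      then show ?thesis using i by auto
    qed
  qed
  then have "card {e \<in> edges ?G. e \<inter> {..<2 * d} \<noteq> {}} \<le>
      card (insert {n - 1, 0} ((\<lambda>i. {i, Suc i mod n}) ` {..<2 * d}))"
    by (intro card_mono) auto
  also have "\<dots> \<le> Suc (card ((\<lambda>i. {i, Suc i mod n}) ` {..<2 * d}))" by (rule card_insert_le_m1) auto
  also have "\<dots> \<le> 2 * d + 1" using card_image_le[of "{..<2 * d}" "\<lambda>i. {i, Suc i mod n}"] by simp
  finally show ?thesis .
qed

section \<open>Cylinders\<close>

abbreviation cylinder :: "nat \<Rightarrow> nat \<Rightarrow> (nat \<times> nat) graph" where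
  "cylinder m n \<equiv> path_graph m \<box> cycle_graph n"

lemma verts_cylinder: "verts (cylinder m n) = {..<m} \<times> {..<n}"
  by (simp add: cartesian_product_def)

lemma edges_cylinder_iff:
  "{(i, j), (i', j')} \<in> edges (cylinder m n) \<longleftrightarrow>
    i < m \<and> i' < m \<and> j < n \<and> j' < n \<and>
    (i = i' \<and> {j, j'} \<in> edges (cycle_graph n) \<or> {i, i'} \<in> edges (path_graph m) \<and> j = j')"
  (is "?L \<longleftrightarrow> ?R")
proof
  assume ?L
  then obtain a b a' b' where "{(i, j), (i', j')} = {(a, b), (a', b')}"
      "a < m" "b < n" "a' < m" "b' < n"
      "a = a' \<and> {b, b'} \<in> edges (cycle_graph n) \<or> {a, a'} \<in> edges (path_graph m) \<and> b = b'"
    unfolding cartesian_product_def by auto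
  then show ?R by (auto simp: doubleton_eq_iff insert_commute)
next
  assume ?R
  then show ?L
    unfolding cartesian_product_def
    by (simp, intro exI[of _ i] exI[of _ j] exI[of _ i'] exI[of _ j']) auto
qed

lemma cylinder_edges_cases:
  assumes "e \<in> edges (cylinder m n)"
  obtains (horizontal) i j where "i < m" "j < n" "e = {(i, j), (i, Suc j mod n)}"
    | (vertical) i j where "Suc i < m" "j < n" "e = {(i, j), (Suc i, j)}"
proof -
  from assms obtain i j i' j' where e: "e = {(i, j), (i', j')}" "i < m" "i' < m" "j < n" "j' < n"
      "i = i' \<and> {j, j'} \<in> edges (cycle_graph n) \<or> {i, i'} \<in> edges (path_graph m) \<and> j = j'"
    unfolding cartesian_product_def by auto
  from e(6) show thesis
  proof
    assume h: "i = i' \<and> {j, j'} \<in> edges (cycle_graph n)"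
    then obtain k where "k < n" "{j, j'} = {k, Suc k mod n}" by (auto elim: cycle_edges_cases)
    then have "e = {(i, k), (i, Suc k mod n)}" using e(1) h by (auto simp: doubleton_eq_iff)
    then show thesis using horizontal \<open>k < n\<close> e(2) by blast
  next
    assume v: "{i, i'} \<in> edges (path_graph m) \<and> j = j'"
    then consider "i' = Suc i" | "i = Suc i'" unfolding edges_path_graph_iff by blast
    then show thesis
      using vertical[of i j] vertical[of i' j] e v by cases (auto simp: insert_commute)
  qed
qed

lemma horizontal_edge:
  assumes "n \<ge> 3" "i < m" "j < n"
  shows "{(i, j), (i, Suc j mod n)} \<in> edges (cylinder m n)"
  using assms unfolding edges_cylinder_iff by (auto simp: cycle_graph_def)

lemma vertical_edge:
  assumes "Suc i < m" "j < n"
  shows "{(i, j), (Suc i, j)} \<in> edges (cylinder m n)"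
  using assms unfolding edges_cylinder_iff edges_path_graph_iff by auto

text \<open>Each of the \<open>m * n\<close> vertices starts one horizontal edge, and each vertex outside the last row starts
one vertical edge; the sum form avoids subtraction of natural numbers.\<close>

lemma card_edges_cylinder:
  assumes "m \<ge> 1" "n \<ge> 3"
  shows "card (edges (cylinder m n)) + n = 2 * (m * n)"
proof -
  let ?h = "\<lambda>(i, j). {(i, j), (i, Suc j mod n)}" and ?v = "\<lambda>(i, j). {(i, j), (Suc i, j)}"
  let ?H = "?h ` ({..<m} \<times> {..<n})" and ?V = "?v ` ({..<m - 1} \<times> {..<n})"
  have E: "edges (cylinder m n) = ?H \<union> ?V"
  proof
    show "edges (cylinder m n) \<subseteq> ?H \<union> ?V"
    proof
      fix e assume "e \<in> edges (cylinder m n)"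
      then show "e \<in> ?H \<union> ?V"
      proof (cases rule: cylinder_edges_cases)
        case (horizontal i j)
        then show ?thesis by (intro UnI1 image_eqI[of _ _ "(i, j)"]) auto
      next
        case (vertical i j)
        then show ?thesis by (intro UnI2 image_eqI[of _ _ "(i, j)"]) auto
      qed
    qed
    show "?H \<union> ?V \<subseteq> edges (cylinder m n)"
      using horizontal_edge[OF assms(2)] vertical_edge by auto
  qed
  have twice: "Suc (Suc j mod n) mod n \<noteq> j" if "j < n" for j
    using that assms by (cases "Suc j = n"; cases "Suc (Suc j) = n") auto
  have suc: "Suc j mod n \<noteq> j" if "j < n" for j
    using that assms by (cases "Suc j = n") auto
  have "inj_on ?h ({..<m} \<times> {..<n})"
    using twice by (auto simp: inj_on_def doubleton_eq_iff) metis
  then have "card ?H = m * n" by (simp add: card_image)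
  moreover have "inj_on ?v ({..<m - 1} \<times> {..<n})"
    by (auto simp: inj_on_def doubleton_eq_iff)
  then have "card ?V = (m - 1) * n" by (simp add: card_image)
  moreover have "?H \<inter> ?V = {}" using suc by (auto simp: doubleton_eq_iff)
  then have "card (edges (cylinder m n)) = card ?H + card ?V"
    unfolding E by (intro card_Un_disjoint) auto
  moreover have "m * n = (m - 1) * n + n" using assms(1) by (cases m) auto
  ultimately show ?thesis by simp
qed

section \<open>Four maximum matchings covering a cylinder\<close>

lemma path_mate_eq_iff [simp]: "even x \<Longrightarrow> path_mate x i = x \<longleftrightarrow> i = x"
  by (auto simp: path_mate_def split: if_splits)

lemma path_mate_simps:
  assumes "odd m" "even x" "x < m" "i < m"
  shows "path_mate x i < m" "path_mate x (path_mate x i) = i"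
    "i \<noteq> x \<Longrightarrow> {i, path_mate x i} \<in> edges (path_graph m)"
  using path_mate_near_perfect[OF assms(1-3)] assms(4) by (auto simp: near_perfect_mate_def)

lemma cycle_mate_simps:
  assumes "odd n" "n \<ge> 3" "x < n" "j < n"
  shows "cycle_mate n x j < n" "cycle_mate n x (cycle_mate n x j) = j"
    "j \<noteq> x \<Longrightarrow> {j, cycle_mate n x j} \<in> edges (cycle_graph n)"
    "cycle_mate n x j = x \<longleftrightarrow> j = x"
proof -
  have *: "cycle_mate n x x = x" "\<And>j. j < n \<Longrightarrow> cycle_mate n x j < n \<and>
      cycle_mate n x (cycle_mate n x j) = j \<and> (j \<noteq> x \<longrightarrow> {j, cycle_mate n x j} \<in> edges (cycle_graph n))"
    using cycle_mate_near_perfect[OF assms(1-3)] by (auto simp: near_perfect_mate_def)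
  show "cycle_mate n x j < n" "cycle_mate n x (cycle_mate n x j) = j"
    "j \<noteq> x \<Longrightarrow> {j, cycle_mate n x j} \<in> edges (cycle_graph n)"
    using * assms(4) by auto
  show "cycle_mate n x j = x \<longleftrightarrow> j = x" using * assms(4) by metis
qed

lemma cycle_mate_self [simp]:
  assumes "odd n" "n \<ge> 3" "x < n"
  shows "cycle_mate n x x = x"
  using cycle_mate_simps(4)[OF assms assms(3)] by simp

lemma near_perfect_mate_cylinderI:
  assumes "x < m" "y < n" "f (x, y) = (x, y)"
    and "\<And>i j. i < m \<Longrightarrow> j < n \<Longrightarrow>
      f (i, j) \<in> {..<m} \<times> {..<n} \<and> f (f (i, j)) = (i, j) \<and>
      ((i, j) \<noteq> (x, y) \<longrightarrow> {(i, j), f (i, j)} \<in> edges (cylinder m n))"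
  shows "near_perfect_mate (cylinder m n) f (x, y)"
  unfolding near_perfect_mate_def verts_cylinder using assms by auto

text \<open>Three shapes of near-perfect matchings of a cylinder with rows \<open>i < m\<close> and columns \<open>j < n\<close>. In
\<open>column_mate\<close>, each row is matched within itself except for its vertex in column \<open>y\<close>, and these
vertices are matched along their column, leaving \<open>(x, y)\<close>. In \<open>row_mate\<close>, all columns are matched
vertically except for row \<open>0\<close>, which is matched within itself. In \<open>rung_mate\<close>, the last row is matched
within itself; above it, the two outermost columns are matched to each other by the horizontal edges
\<open>{(i, n - 1), (i, 0)}\<close> (the rungs of the ladder formed by those columns), and the others vertically.\<close>

definition column_mate :: "nat \<Rightarrow> nat \<Rightarrow> nat \<Rightarrow> nat \<times> nat \<Rightarrow> nat \<times> nat" where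
  "column_mate n x y = (\<lambda>(i, j). if j = y then (path_mate x i, j) else (i, cycle_mate n y j))"

definition row_mate :: "nat \<Rightarrow> nat \<times> nat \<Rightarrow> nat \<times> nat" where
  "row_mate n = (\<lambda>(i, j). if i = 0 then (i, cycle_mate n 0 j) else (path_mate 0 i, j))"

definition rung_mate :: "nat \<Rightarrow> nat \<Rightarrow> nat \<times> nat \<Rightarrow> nat \<times> nat" where
  "rung_mate m n = (\<lambda>(i, j). if i = m - 1 \<or> j = 0 \<or> j = n - 1
     then (i, cycle_mate n (n - 2) j) else (path_mate (m - 1) i, j))"

lemma column_mate_near_perfect:
  assumes "odd m" "odd n" "n \<ge> 3" "even x" "x < m" "y < n"
  shows "near_perfect_mate (cylinder m n) (column_mate n x y) (x, y)"
proof (rule near_perfect_mate_cylinderI)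
  fix i j assume "i < m" "j < n"
  then show "column_mate n x y (i, j) \<in> {..<m} \<times> {..<n} \<and>
      column_mate n x y (column_mate n x y (i, j)) = (i, j) \<and>
      ((i, j) \<noteq> (x, y) \<longrightarrow> {(i, j), column_mate n x y (i, j)} \<in> edges (cylinder m n))"
    using path_mate_simps[OF assms(1,4,5), of i] cycle_mate_simps[OF assms(2,3,6), of j]
    by (auto simp: column_mate_def edges_cylinder_iff)
qed (use assms in \<open>auto simp: column_mate_def\<close>)

lemma row_mate_near_perfect:
  assumes "odd m" "odd n" "n \<ge> 3"
  shows "near_perfect_mate (cylinder m n) (row_mate n) (0, 0)"
proof (rule near_perfect_mate_cylinderI)
  fix i j assume "i < m" "j < n"
  moreover have "0 < m" "0 < n" using assms by (auto intro: odd_pos)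
  ultimately show "row_mate n (i, j) \<in> {..<m} \<times> {..<n} \<and>
      row_mate n (row_mate n (i, j)) = (i, j) \<and>
      ((i, j) \<noteq> (0, 0) \<longrightarrow> {(i, j), row_mate n (i, j)} \<in> edges (cylinder m n))"
    using path_mate_simps[OF assms(1), of 0 i] cycle_mate_simps[OF assms(2,3), of 0 j]
    by (auto simp: row_mate_def edges_cylinder_iff)
qed (use assms odd_pos[of m] in \<open>auto simp: row_mate_def\<close>)

lemma rung_mate_near_perfect:
  assumes "odd m" "odd n" "n \<ge> 3"
  shows "near_perfect_mate (cylinder m n) (rung_mate m n) (m - 1, n - 2)"
proof (rule near_perfect_mate_cylinderI)
  have odd: "odd (n - 2)" using assms by (auto elim!: oddE)
  \<comment> \<open>The vertex \<open>n - 2\<close> is odd, so the matching of the last row that misses it uses the edge \<open>{n - 1, 0}\<close>.\<close>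
  have ends: "cycle_mate n (n - 2) 0 = n - 1" "cycle_mate n (n - 2) (n - 1) = 0"
    using odd assms by (auto simp: cycle_mate_def)
  fix i j assume ij: "i < m" "j < n"
  moreover have "even (m - 1)" "m - 1 < m" "n - 2 < n" "n - 2 \<noteq> n - 1" "n - 2 \<noteq> 0"
    using assms by (auto elim!: oddE)
  ultimately show "rung_mate m n (i, j) \<in> {..<m} \<times> {..<n} \<and>
      rung_mate m n (rung_mate m n (i, j)) = (i, j) \<and>
      ((i, j) \<noteq> (m - 1, n - 2) \<longrightarrow> {(i, j), rung_mate m n (i, j)} \<in> edges (cylinder m n))"
    using path_mate_simps[OF assms(1), of "m - 1" i] cycle_mate_simps[OF assms(2,3), of "n - 2" j]
      ends path_mate_eq_iff[of "m - 1" i]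
    by (auto simp: rung_mate_def edges_cylinder_iff)
qed (use assms odd_pos[of m] in \<open>auto simp: rung_mate_def\<close>)

text \<open>Four matchings that together cover every edge. The matchings with gaps in the columns \<open>n - 1\<close> and
\<open>0\<close> cover all horizontal edges except the rungs \<open>{(i, n - 1), (i, 0)}\<close>, which \<open>rung_mate\<close>
covers in every row. Vertical edges from odd rows to the next row belong to \<open>row_mate\<close>; those from even
rows belong to \<open>rung_mate\<close> in the inner columns, and to the first two matchings in the two columns
where \<open>rung_mate\<close> uses the rungs instead.\<close>

definition cover_mate :: "nat \<Rightarrow> nat \<Rightarrow> nat \<Rightarrow> nat \<times> nat \<Rightarrow> nat \<times> nat" where
  "cover_mate m n k =
    (if k = 0 then column_mate n (m - 1) (n - 1) else if k = 1 then column_mate n (m - 1) 0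
     else if k = 2 then row_mate n else rung_mate m n)"

lemma cover_mate_near_perfect:
  assumes "odd m" "odd n" "n \<ge> 3"
  shows "\<exists>v. near_perfect_mate (cylinder m n) (cover_mate m n k) v"
proof -
  have "even (m - 1)" "m - 1 < m" "0 < n" "n - 1 < n" using assms by (auto elim!: oddE)
  then show ?thesis
    using column_mate_near_perfect[OF assms, of "m - 1"] row_mate_near_perfect[OF assms]
      rung_mate_near_perfect[OF assms] unfolding cover_mate_def by auto
qed

lemma cover_mate_covers:
  assumes "odd m" "odd n" "n \<ge> 3"
  shows "edges (cylinder m n) \<subseteq> (\<Union>k\<in>{..<4}. mate_edges (cylinder m n) (cover_mate m n k))"
proof
  fix e assume "e \<in> edges (cylinder m n)"
  then have "\<exists>k v w. k < 4 \<and> e = {v, w} \<and> v \<in> verts (cylinder m n) \<and> cover_mate m n k v = w \<and> v \<noteq> w"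
  proof (cases rule: cylinder_edges_cases)
    case (horizontal i j)
    define k :: nat where "k = (if j = n - 1 then 3 else if even j then 0 else 1)"
    obtain q where q: "n = 2 * q + 1" using assms by (auto elim!: oddE)
    have "cover_mate m n k (i, j) = (i, Suc j mod n)"
    proof (cases "j = n - 1")
      case True
      then show ?thesis using assms q
        by (auto simp: k_def cover_mate_def rung_mate_def cycle_mate_def)
    next
      case False
      then show ?thesis using horizontal(2) q
        by (auto simp: k_def cover_mate_def column_mate_def cycle_mate_def path_mate_def)
    qed
    moreover have "k < 4" by (simp add: k_def)
    moreover have "Suc j mod n \<noteq> j" using horizontal(2) assms(3) by (cases "Suc j = n") auto
    ultimately show ?thesis
      using horizontal verts_cylinder
      by (intro exI[of _ k] exI[of _ "(i, j)"] exI[of _ "(i, Suc j mod n)"]) auto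
  next
    case (vertical i j)
    define k :: nat where "k = (if odd i then 2 else if j = n - 1 then 0 else if j = 0 then 1 else 3)"
    have "cover_mate m n k (i, j) = (Suc i, j)"
      using vertical(1,2) assms
      by (auto simp: k_def cover_mate_def rung_mate_def row_mate_def column_mate_def path_mate_def)
    moreover have "k < 4" by (simp add: k_def)
    ultimately show ?thesis
      using vertical verts_cylinder
      by (intro exI[of _ k] exI[of _ "(i, j)"] exI[of _ "(Suc i, j)"]) auto
  qed
  then show "e \<in> (\<Union>k\<in>{..<4}. mate_edges (cylinder m n) (cover_mate m n k))"
    using mate_edgesI[of _ "cylinder m n"] by (metis UN_I lessThan_iff)
qed

section \<open>Three disjoint maximum matchings of a cylinder\<close>

text \<open>Together with \<open>column_mate n 2 (n - 1)\<close>, the next two matchings form a proper partial 3-colouring of the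
edges. Rows from 3 on are grouped in pairs: within a row, the colours of the edges alternate
between first and second, starting with the first at column \<open>0\<close>, and the edge \<open>{n - 1, 0}\<close> gets the
third colour; each vertex then misses one colour, and the vertical edge inside the pair receives it. As \<open>m\<close> is odd,
the top three rows form a separate block. There row \<open>0\<close> is coloured like the rows from 3 on and row \<open>2\<close>
with second and third colour exchanged, so in the inner columns row \<open>1\<close> receives the third colour
from above and the second from below, and needs only the first within itself. The exceptions in the
outermost columns leave one vertex uncovered by each colour, namely \<open>(2, n - 1)\<close>, \<open>(1, n - 1)\<close>
and \<open>(1, n - 1)\<close>.\<close>

definition second_mate :: "nat \<Rightarrow> nat \<times> nat \<Rightarrow> nat \<times> nat" where
  "second_mate n = (\<lambda>(i, j).
     if i = 2 then (if j = 0 \<or> j = n - 1 then (2, n - 1 - j) else (1, j))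
     else if i = 1 then (if j = 0 then (0, 0) else if j = n - 1 then (1, j) else (2, j))
     else if j = 0 then (path_mate 2 i, j) else (i, cycle_mate n 0 j))"

definition third_mate :: "nat \<Rightarrow> nat \<times> nat \<Rightarrow> nat \<times> nat" where
  "third_mate n = (\<lambda>(i, j).
     if i = 2 then (if j = 0 then (1, 0) else (2, cycle_mate n 0 j))
     else if i = 1 then (if j = 0 then (2, 0) else if j = n - 1 then (1, j) else (0, j))
     else if j = 0 \<or> j = n - 1 then (i, n - 1 - j) else (path_mate 2 i, j))"

lemma path_mate_2:
  "path_mate 2 0 = 1" "path_mate 2 (Suc 0) = 0" "i > 2 \<Longrightarrow> path_mate 2 i > 2"
  "i > 2 \<Longrightarrow> path_mate 2 i \<noteq> Suc 0" "i > 2 \<Longrightarrow> path_mate 2 i \<noteq> 0"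
  by (auto simp: path_mate_def)

lemma second_mate_near_perfect:
  assumes "odd m" "m \<ge> 3" "odd n" "n \<ge> 3"
  shows "near_perfect_mate (cylinder m n) (second_mate n) (1, n - 1)"
proof (rule near_perfect_mate_cylinderI)
  fix i j assume ij: "i < m" "j < n"
  consider "i = 0" | "i = 1" | "i = 2" | "i > 2" by linarith
  then show "second_mate n (i, j) \<in> {..<m} \<times> {..<n} \<and>
      second_mate n (second_mate n (i, j)) = (i, j) \<and>
      ((i, j) \<noteq> (1, n - 1) \<longrightarrow> {(i, j), second_mate n (i, j)} \<in> edges (cylinder m n))"
    using ij assms path_mate_simps[OF assms(1), of 2 i] cycle_mate_simps[OF assms(3,4), of 0 j]
      path_mate_2(3)[of i]
    by cases (auto simp: second_mate_def edges_cylinder_iff edges_path_graph_iff path_mate_2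
        edges_cycle_graph_iff)
qed (use assms in \<open>auto simp: second_mate_def\<close>)

lemma third_mate_near_perfect:
  assumes "odd m" "m \<ge> 3" "odd n" "n \<ge> 3"
  shows "near_perfect_mate (cylinder m n) (third_mate n) (1, n - 1)"
proof (rule near_perfect_mate_cylinderI)
  fix i j assume ij: "i < m" "j < n"
  consider "i = 0" | "i = 1" | "i = 2" | "i > 2" by linarith
  then show "third_mate n (i, j) \<in> {..<m} \<times> {..<n} \<and>
      third_mate n (third_mate n (i, j)) = (i, j) \<and>
      ((i, j) \<noteq> (1, n - 1) \<longrightarrow> {(i, j), third_mate n (i, j)} \<in> edges (cylinder m n))"
    using ij assms path_mate_simps[OF assms(1), of 2 i] cycle_mate_simps[OF assms(3,4), of 0 j]
      path_mate_2(3)[of i]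
    by cases (auto simp: third_mate_def edges_cylinder_iff edges_path_graph_iff path_mate_2
        edges_cycle_graph_iff)
qed (use assms in \<open>auto simp: third_mate_def\<close>)

definition colour_mate :: "nat \<Rightarrow> nat \<Rightarrow> nat \<times> nat \<Rightarrow> nat \<times> nat" where
  "colour_mate n k = (if k = 0 then column_mate n 2 (n - 1) else if k = 1 then second_mate n else third_mate n)"

lemma cycle_mates_differ:
  assumes "odd n" "n \<ge> 3" "0 < j" "j < n - 1"
  shows "cycle_mate n (n - 1) j \<noteq> cycle_mate n 0 j" "cycle_mate n (n - 1) j \<noteq> j" "cycle_mate n 0 j \<noteq> j"
  using assms by (auto simp: cycle_mate_def path_mate_def)

lemma cycle_mate_last:
  assumes "odd n" "n \<ge> 3"
  shows "cycle_mate n (n - 1) 0 = Suc 0" "cycle_mate n 0 (n - 1) = n - 2"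
  using assms by (auto simp: cycle_mate_def path_mate_def)

lemma colour_mates_disjoint:
  assumes "odd m" "m \<ge> 3" "odd n" "n \<ge> 3"
  shows "mate_edges (cylinder m n) (column_mate n 2 (n - 1)) \<inter>
      mate_edges (cylinder m n) (second_mate n) = {}" (is ?one)
    and "mate_edges (cylinder m n) (column_mate n 2 (n - 1)) \<inter>
      mate_edges (cylinder m n) (third_mate n) = {}" (is ?two)
    and "mate_edges (cylinder m n) (second_mate n) \<inter>
      mate_edges (cylinder m n) (third_mate n) = {}" (is ?three)
proof -
  have np: "near_perfect_mate (cylinder m n) (column_mate n 2 (n - 1)) (2, n - 1)"
    using assms by (intro column_mate_near_perfect) auto
  note np2 = second_mate_near_perfect[OF assms] and np3 = third_mate_near_perfect[OF assms]
  have rows: "path_mate 2 i \<noteq> i" if "i \<noteq> 2" for i using that by (auto simp: path_mate_def)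
  have aux: "column_mate n 2 (n - 1) v \<noteq> second_mate n v \<and> column_mate n 2 (n - 1) v \<noteq> third_mate n v"
    if moved: "v \<in> verts (cylinder m n)" "column_mate n 2 (n - 1) v \<noteq> v" for v
  proof -
    obtain i j where v: "v = (i, j)" "i < m" "j < n"
      using moved(1) unfolding verts_cylinder by blast
    consider "j = 0" | "j = n - 1" | "0 < j" "j < n - 1" using v(3) by linarith
    then show ?thesis
      using moved(2) v assms cycle_mate_last[OF assms(3,4)] cycle_mates_differ[OF assms(3,4), of j]
        path_mate_2 rows[of i]
      by cases (auto simp: column_mate_def second_mate_def third_mate_def split: if_splits)
  qed
  have aux2: "second_mate n v \<noteq> third_mate n v"
    if moved: "v \<in> verts (cylinder m n)" "second_mate n v \<noteq> v" for v
  proof -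
    obtain i j where v: "v = (i, j)" "i < m" "j < n"
      using moved(1) unfolding verts_cylinder by blast
    consider "j = 0" | "j = n - 1" | "0 < j" "j < n - 1" using v(3) by linarith
    then show ?thesis
      using moved(2) v assms cycle_mate_last[OF assms(3,4)] cycle_mates_differ[OF assms(3,4), of j]
        path_mate_2 rows[of i]
      by cases (auto simp: second_mate_def third_mate_def split: if_splits)
  qed
  show ?one ?two ?three
    using mate_edges_disjoint[OF np np2] mate_edges_disjoint[OF np np3]
      mate_edges_disjoint[OF np2 np3] aux aux2 by blast+
qed

lemma odd_near_perfect_cylinder:
  assumes "odd m" "odd n" "n \<ge> 3"
  shows "odd_near_perfect (cylinder m n) ((m * n - 1) div 2)"
proof
  show "simple_graph (cylinder m n)"
    by (intro simple_graph_cartesian_product simple_graph_path simple_graph_cycle assms)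
  have "odd (m * n)" using assms by simp
  then show "card (verts (cylinder m n)) = 2 * ((m * n - 1) div 2) + 1"
    by (auto simp: verts_cylinder elim!: oddE)
  show "\<exists>f x. near_perfect_mate (cylinder m n) f x"
    using row_mate_near_perfect[OF assms] by blast
qed

lemma colour_mate_near_perfect:
  assumes "odd m" "m \<ge> 3" "odd n" "n \<ge> 3"
  shows "\<exists>v. near_perfect_mate (cylinder m n) (colour_mate n k) v"
  using column_mate_near_perfect[of m n 2 "n - 1"] second_mate_near_perfect[OF assms]
    third_mate_near_perfect[OF assms] assms unfolding colour_mate_def by auto

lemma three_d_le_transversal_number_cylinder:
  assumes "odd m" "m \<ge> 3" "odd n" "n \<ge> 3" and d: "1 \<le> d" "d \<le> (m * n - 1) div 2"
  shows "3 * d \<le> transversal_number (int d) (cylinder m n)"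
proof -
  let ?G = "cylinder m n"
  interpret odd_near_perfect ?G "(m * n - 1) div 2"
    by (rule odd_near_perfect_cylinder[OF assms(1,3,4)])
  obtain T where T: "T \<subseteq> edges ?G" "\<And>M. maximum_matching ?G M \<Longrightarrow> d \<le> card (T \<inter> M)"
      "card T = transversal_number (int d) ?G"
    using transversal_number_attained[OF d] by blast
  have finT: "finite T" using T(1) finite_edges[OF simple] finite_subset by blast
  let ?M = "\<lambda>k. mate_edges ?G (colour_mate n k)"
  have "maximum_matching ?G (?M k)" for k
    using colour_mate_near_perfect[OF assms(1-4), of k] maximum_mate_edges by blast
  moreover have "?M k \<inter> ?M l = {}" if "k < 3" "l < 3" "k \<noteq> l" for k l
  proof -
    have "k \<in> {0, 1, 2}" "l \<in> {0, 1, 2}" using that by auto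
    then show ?thesis
      using that(3) colour_mates_disjoint[OF assms(1-4)]
      by (auto simp: colour_mate_def Int_commute)
  qed
  ultimately have "card {..<3 :: nat} * d \<le> card (T \<inter> (\<Union>k\<in>{..<3}. ?M k))"
    using T(2) by (intro disjoint_maximum_matchings_bound) auto
  also have "\<dots> \<le> card T" using finT by (intro card_mono) auto
  finally show ?thesis using T(3) by simp
qed

lemma four_d_le_transversal_number_cylinder:
  assumes "odd m" "odd n" "n \<ge> 3" and d: "1 \<le> d" "d \<le> (m * n - 1) div 2"
  shows "4 * d + 2 \<le> transversal_number (int d) (cylinder m n) + n"
proof -
  let ?G = "cylinder m n" and ?\<nu> = "(m * n - 1) div 2"
  interpret odd_near_perfect ?G ?\<nu>
    by (rule odd_near_perfect_cylinder[OF assms(1-3)])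
  obtain T where T: "T \<subseteq> edges ?G" "\<And>M. maximum_matching ?G M \<Longrightarrow> d \<le> card (T \<inter> M)"
      "card T = transversal_number (int d) ?G"
    using transversal_number_attained[OF d] by blast
  let ?M = "\<lambda>k. mate_edges ?G (cover_mate m n k)"
  have "maximum_matching ?G (?M k)" for k
    using cover_mate_near_perfect[OF assms(1-3), of k] maximum_mate_edges by blast
  then have "card (edges ?G) \<le> card T + card {..<4 :: nat} * (?\<nu> - d)"
    using T(1,2) d(2) cover_mate_covers[OF assms(1-3)]
    by (intro covering_maximum_matchings_bound) auto
  moreover have "card (edges ?G) + n = 2 * (m * n)"
    using assms by (intro card_edges_cylinder) (auto simp: Suc_le_eq intro: odd_pos)
  moreover have "m * n = 2 * ?\<nu> + 1"
    using card_verts by (simp add: verts_cylinder)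
  ultimately show ?thesis using T(3) d(2) by simp
qed

section \<open>Upper bounds for cylinders\<close>

text \<open>Take the first \<open>2 * d\<close> vertices in lexicographic order. An edge meeting this initial segment \<open>A\<close> starts (to
the right or downwards) at a vertex of \<open>A\<close>, with one possible exception: the edge that closes up
the incomplete last row of \<open>A\<close>. Two edges per vertex and the exceptional one make \<open>4 * d + 1\<close>.\<close>

lemma transversal_number_cylinder_le_lexicographic:
  assumes "odd m" "odd n" "n \<ge> 3" and d: "1 \<le> d" "d \<le> (m * n - 1) div 2"
  shows "transversal_number (int d) (cylinder m n) \<le> 4 * d + 1"
proof -
  let ?G = "cylinder m n"
  interpret odd_near_perfect ?G "(m * n - 1) div 2"
    by (rule odd_near_perfect_cylinder[OF assms(1-3)])
  define A where "A = (\<lambda>x. (x div n, x mod n)) ` {..<2 * d}"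
  have A_iff: "(i, j) \<in> A \<longleftrightarrow> j < n \<and> i * n + j < 2 * d" for i j
  proof
    assume "(i, j) \<in> A"
    then show "j < n \<and> i * n + j < 2 * d" using assms(3) by (auto simp: A_def)
  next
    assume "j < n \<and> i * n + j < 2 * d"
    then show "(i, j) \<in> A" unfolding A_def by (intro image_eqI[of _ _ "i * n + j"]) auto
  qed
  have "inj_on (\<lambda>x. (x div n, x mod n)) {..<2 * d}"
    by (rule inj_onI) (metis Pair_inject div_mult_mod_eq)
  then have cardA: "card A = 2 * d" by (simp add: A_def card_image)
  have finA: "finite A" by (simp add: A_def)
  have "A \<subseteq> verts ?G"
  proof
    fix v assume "v \<in> A"
    then obtain i j where v: "v = (i, j)" "j < n" "i * n + j < 2 * d" using A_iff by (cases v) auto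
    then have "i * n < m * n" using d(2) by linarith
    then show "v \<in> verts ?G" using v by (simp add: verts_cylinder)
  qed
  then have "transversal_number (int d) ?G \<le> card {e \<in> edges ?G. e \<inter> A \<noteq> {}}"
    using d cardA by (intro transversal_number_le_edges_meeting) auto
  also have "\<dots> \<le> card (insert {(2 * d div n, n - 1), (2 * d div n, 0)}
      ((\<lambda>(i, j). {(i, j), (i, Suc j mod n)}) ` A \<union> (\<lambda>(i, j). {(i, j), (Suc i, j)}) ` A))"
    (is "_ \<le> card (insert ?w (?R \<union> ?D))")
  proof (intro card_mono subsetI)
    show "finite (insert ?w (?R \<union> ?D))" using finA by simp
    fix e assume "e \<in> {e \<in> edges ?G. e \<inter> A \<noteq> {}}"
    then have e: "e \<in> edges ?G" "e \<inter> A \<noteq> {}" by auto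
    from e(1) show "e \<in> insert ?w (?R \<union> ?D)"
    proof (cases rule: cylinder_edges_cases)
      case (horizontal i j)
      show ?thesis
      proof (cases "(i, j) \<in> A")
        case True
        then show ?thesis using horizontal(3) by force
      next
        case False
        then have next_in: "(i, Suc j mod n) \<in> A" using e(2) horizontal(3) by auto
        have "Suc j = n"
        proof (rule ccontr)
          assume "Suc j \<noteq> n"
          then have "Suc j < n" using horizontal(2) by simp
          then show False using next_in False horizontal(2) by (simp add: A_iff)
        qed
        then have "i * n < 2 * d" "2 * d \<le> i * n + (n - 1)" "j = n - 1"
          using next_in False by (auto simp: A_iff)
        then have "2 * d div n = i"
          using assms(3) by (intro div_nat_eqI) (auto simp: algebra_simps)
        then show ?thesis using horizontal(3) \<open>Suc j = n\<close> \<open>j = n - 1\<close> by simp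
      qed
    next
      case (vertical i j)
      then have "(i, j) \<in> A" using e(2) by (auto simp: A_iff)
      then show ?thesis using vertical(3) by force
    qed
  qed
  also have "\<dots> \<le> Suc (card (?R \<union> ?D))" using finA by (simp add: card_insert_if)
  also have "\<dots> \<le> Suc (card ?R + card ?D)" by (simp add: card_Un_le)
  also have "\<dots> \<le> 4 * d + 1"
    using card_image_le[OF finA, of "\<lambda>(i, j). {(i, j), (i, Suc j mod n)}"]
      card_image_le[OF finA, of "\<lambda>(i, j). {(i, j), (Suc i, j)}"] cardA by simp
  finally show ?thesis .
qed

text \<open>Independent vertices in all rows: in columns \<open>0\<close> to \<open>n - 2\<close>, the vertices whose two coordinates have
the same parity. Leaving column \<open>n - 1\<close> empty is what makes this work although the rows are odd
cycles. Row \<open>i\<close> contributes one vertex for each \<open>t < (n - 1) div 2\<close>.\<close>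

definition checkerboard :: "nat \<times> nat \<Rightarrow> nat \<times> nat" where
  "checkerboard = (\<lambda>(i, t). (i, 2 * t + i mod 2))"

lemma inj_checkerboard: "inj checkerboard"
  by (auto simp: inj_def checkerboard_def)

lemma degree_cylinder_ge:
  assumes "m \<ge> 3" "n \<ge> 3" "i < m" "j < n"
  shows "(if 0 < i \<and> i < m - 1 then 4 else 3) \<le> card {e \<in> edges (cylinder m n). (i, j) \<in> e}"
proof -
  let ?l = "if j = 0 then n - 1 else j - 1" and ?r = "if j = n - 1 then 0 else Suc j"
  let ?N = "{(i, ?l), (i, ?r)} \<union> (if Suc i < m then {(Suc i, j)} else {}) \<union> (if 0 < i then {(i - 1, j)} else {})"
  have "?l \<noteq> ?r" using assms by auto
  then have "(if 0 < i \<and> i < m - 1 then 4 else 3) \<le> card ?N" using assms by auto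
  also have "card ?N = card ((\<lambda>u. {(i, j), u}) ` ?N)"
    by (rule card_image[symmetric]) (auto simp: inj_on_def doubleton_eq_iff)
  also have "\<dots> \<le> card {e \<in> edges (cylinder m n). (i, j) \<in> e}"
  proof (rule card_mono)
    have "simple_graph (cylinder m n)"
      using assms by (intro simple_graph_cartesian_product simple_graph_path simple_graph_cycle)
    then show "finite {e \<in> edges (cylinder m n). (i, j) \<in> e}" by (simp add: finite_edges)
    show "(\<lambda>u. {(i, j), u}) ` ?N \<subseteq> {e \<in> edges (cylinder m n). (i, j) \<in> e}"
      using assms by (auto simp: edges_cylinder_iff edges_path_graph_iff edges_cycle_graph_iff)
  qed
  finally show ?thesis .
qed

lemma transversal_number_cylinder_le_checkerboard:
  assumes m: "odd m" "m \<ge> 3" and n: "odd n" "n \<ge> 3"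
    and d: "1 \<le> d" "d + card J = (m * n - 1) div 2"
    and J: "J \<subseteq> {..<m} \<times> {..<(n - 1) div 2}"
  shows "transversal_number (int d) (cylinder m n) + (\<Sum>(i, t)\<in>J. if 0 < i \<and> i < m - 1 then 4 else 3)
    \<le> card (edges (cylinder m n))"
proof -
  let ?G = "cylinder m n" and ?\<nu> = "(m * n - 1) div 2"
  interpret odd_near_perfect ?G ?\<nu> by (rule odd_near_perfect_cylinder[OF m(1) n])
  have inj: "inj_on checkerboard J" using inj_checkerboard inj_on_subset by blast
  have J_D: "i < m" "Suc (2 * t + i mod 2) < n" if "(i, t) \<in> J" for i t
  proof -
    show "i < m" using that J by auto
    have "t < (n - 1) div 2" using that J by auto
    then show "Suc (2 * t + i mod 2) < n" using n(1) by (auto elim!: oddE)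
  qed
  have "transversal_number (int d) ?G + (\<Sum>v\<in>checkerboard ` J. card {e \<in> edges ?G. v \<in> e}) \<le> card (edges ?G)"
  proof (rule transversal_number_le_independent)
    show "d + card (checkerboard ` J) = ?\<nu>" using d(2) inj by (simp add: card_image)
    show "checkerboard ` J \<subseteq> verts ?G"
      using J_D by (force simp: verts_cylinder checkerboard_def)
    fix u v assume "u \<in> checkerboard ` J" "v \<in> checkerboard ` J"
    then obtain i t i' t' where uv: "(i, t) \<in> J" "(i', t') \<in> J"
        "u = (i, 2 * t + i mod 2)" "v = (i', 2 * t' + i' mod 2)"
      by (auto simp: checkerboard_def)
    show "{u, v} \<notin> edges ?G"
    proof
      assume "{u, v} \<in> edges ?G"
      then have "i = i' \<and> {2 * t + i mod 2, 2 * t' + i' mod 2} \<in> edges (cycle_graph n) \<or>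
          {i, i'} \<in> edges (path_graph m) \<and> 2 * t + i mod 2 = 2 * t' + i' mod 2"
        unfolding uv edges_cylinder_iff by blast
      then show False
      proof
        assume "i = i' \<and> {2 * t + i mod 2, 2 * t' + i' mod 2} \<in> edges (cycle_graph n)"
        then have "2 * t + i mod 2 = Suc (2 * t' + i mod 2) \<or> 2 * t' + i mod 2 = Suc (2 * t + i mod 2)"
          using J_D[OF uv(1)] J_D[OF uv(2)] unfolding edges_cycle_graph_iff[OF n(2)] by auto
        then show False by (elim disjE) presburger+
      next
        assume "{i, i'} \<in> edges (path_graph m) \<and> 2 * t + i mod 2 = 2 * t' + i' mod 2"
        then have "i' = Suc i \<or> i = Suc i'" "2 * t + i mod 2 = 2 * t' + i' mod 2"
          unfolding edges_path_graph_iff by auto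
        from this(2) have "even (2 * t + i mod 2) \<longleftrightarrow> even (2 * t' + i' mod 2)" by (rule arg_cong)
        then have "even i \<longleftrightarrow> even i'" by simp
        then show False using \<open>i' = Suc i \<or> i = Suc i'\<close> by auto
      qed
    qed
  qed (use d in auto)
  moreover have "(\<Sum>(i, t)\<in>J. if 0 < i \<and> i < m - 1 then 4 else 3) \<le>
      (\<Sum>x\<in>J. card {e \<in> edges ?G. checkerboard x \<in> e})"
  proof (rule sum_mono)
    fix x assume "x \<in> J"
    then show "(case x of (i, t) \<Rightarrow> if 0 < i \<and> i < m - 1 then 4 else 3) \<le>
        card {e \<in> edges ?G. checkerboard x \<in> e}"
      using J_D[of "fst x" "snd x"] degree_cylinder_ge[OF m(2) n(2), of "fst x" "2 * snd x + fst x mod 2"]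
      by (cases x) (auto simp: checkerboard_def)
  qed
  ultimately show ?thesis by (simp add: sum.reindex[OF inj] o_def)
qed

text \<open>Vertices outside the first and last row have degree 4, so if these suffice, each unit of \<open>\<nu> - d\<close> removes
four edges from the transversal.\<close>

lemma transversal_number_cylinder_le_inner:
  assumes m: "odd m" "m \<ge> 3" and n: "odd n" "n \<ge> 3"
    and d: "1 \<le> d" "d + k = (m * n - 1) div 2" and k: "k \<le> (m - 2) * ((n - 1) div 2)"
  shows "transversal_number (int d) (cylinder m n) + 4 * k \<le> card (edges (cylinder m n))"
proof -
  have "k \<le> card ({1..<m - 1} \<times> {..<(n - 1) div 2})" using k by (simp add: numeral_2_eq_2)
  then obtain J where J: "J \<subseteq> {1..<m - 1} \<times> {..<(n - 1) div 2}" "card J = k" "finite J"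
    by (rule obtain_subset_with_card_n)
  have "(\<Sum>(i, t)\<in>J. if 0 < i \<and> i < m - 1 then 4 else 3) = (\<Sum>x\<in>J. 4 :: nat)"
    using J(1) by (intro sum.cong) auto
  then show ?thesis
    using transversal_number_cylinder_le_checkerboard[OF m n d(1), of J] J d(2) by force
qed

text \<open>Beyond the capacity \<open>(m - 2) * ((n - 1) div 2)\<close> of the inner rows, the remaining \<open>k\<close> vertices are taken
from the first and last row, where they have degree 3.\<close>

lemma transversal_number_cylinder_le_outer:
  assumes m: "odd m" "m \<ge> 3" and n: "odd n" "n \<ge> 3"
    and d: "1 \<le> d" "d + ((m - 2) * ((n - 1) div 2) + k) = (m * n - 1) div 2" and k: "k \<le> n - 1"
  shows "transversal_number (int d) (cylinder m n) + (4 * ((m - 2) * ((n - 1) div 2)) + 3 * k)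
    \<le> card (edges (cylinder m n))"
proof -
  let ?q = "(n - 1) div 2"
  have "card ({0, m - 1} \<times> {..<?q}) = n - 1" using m(2) n(1) by (auto elim!: oddE)
  then have "k \<le> card ({0, m - 1} \<times> {..<?q})" using k by simp
  then obtain J where J: "J \<subseteq> {0, m - 1} \<times> {..<?q}" "card J = k" "finite J"
    by (rule obtain_subset_with_card_n)
  let ?I = "{1..<m - 1} \<times> {..<?q}"
  have disj: "?I \<inter> J = {}" using J(1) by auto
  have cardI: "card ?I = (m - 2) * ?q" by (simp add: numeral_2_eq_2)
  have card: "card (?I \<union> J) = (m - 2) * ?q + k"
    using disj J cardI by (subst card_Un_disjoint) auto
  have "(\<Sum>(i, t)\<in>?I. if 0 < i \<and> i < m - 1 then 4 else 3) = (\<Sum>x\<in>?I. 4 :: nat)"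
    by (intro sum.cong) auto
  moreover have "(\<Sum>(i, t)\<in>J. if 0 < i \<and> i < m - 1 then 4 else 3) = (\<Sum>x\<in>J. 3 :: nat)"
    using J(1) by (intro sum.cong) auto
  ultimately have "(\<Sum>(i, t)\<in>?I \<union> J. if 0 < i \<and> i < m - 1 then 4 else 3) = 4 * ((m - 2) * ?q) + 3 * k"
    using disj J(2,3) cardI by (subst sum.union_disjoint) (simp_all add: mult.commute)
  moreover have "?I \<union> J \<subseteq> {..<m} \<times> {..<?q}" using J(1) m(2) by auto
  ultimately show ?thesis
    using transversal_number_cylinder_le_checkerboard[OF m n d(1), of "?I \<union> J"] d(2) card by simp
qed

theorem theorem3p19:
  fixes m n :: nat and d :: int
  assumes "odd m" and "odd n"
  shows
    "(n \<ge> 3 \<longrightarrow>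
        1 \<le> d \<and> d \<le> (int n - 1) div 2 \<longrightarrow>
        int (transversal_number d (cycle_graph n)) = 2 * d + 1) \<and>
     (m \<ge> 3 \<and> n \<ge> 3 \<longrightarrow>
        (1 \<le> d \<and> d \<le> (int m - 3) div 2 \<longrightarrow>
           max (3 * d) (4 * d - int n + 2) \<le> int (transversal_number d (path_graph m \<box> cycle_graph n)) \<and>
           int (transversal_number d (path_graph m \<box> cycle_graph n)) \<le> 4 * d + 1) \<and>
        ((int m - 1) div 2 \<le> d \<and> d \<le> (int m - 5) div 2 + int n \<longrightarrow>
           max (3 * d) (4 * d - int n + 2) \<le> int (transversal_number d (path_graph m \<box> cycle_graph n)) \<and>
           int (transversal_number d (path_graph m \<box> cycle_graph n)) \<le> 3 * d + (int m + 1) div 2) \<and>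
        ((int m - 3) div 2 + int n \<le> d \<and> d \<le> (int m * int n - 1) div 2 \<longrightarrow>
           int (transversal_number d (path_graph m \<box> cycle_graph n)) = 4 * d - int n + 2))"
proof -
  obtain p q where pq: "m = 2 * p + 1" "n = 2 * q + 1" using assms by (auto elim!: oddE)
  \<comment> \<open>Naming the only product makes all remaining arithmetic linear.\<close>
  define r where "r = p * q"
  have \<nu>: "(m * n - 1) div 2 = 2 * r + p + q" by (simp add: pq r_def algebra_simps)
  have \<nu>_int: "(int m * int n - 1) div 2 = int (2 * r + p + q)" by (simp add: pq r_def algebra_simps)
  have r: "p \<le> r" "q \<le> r" if "m \<ge> 3" "n \<ge> 3" using that by (auto simp: pq r_def)
  have halves: "(int n - 1) div 2 = int q" "(int m - 3) div 2 = int p - 1" "(int m - 1) div 2 = int p"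
    "(int m - 5) div 2 = int p - 2" "(int m + 1) div 2 = int p + 1" "(n - 1) div 2 = q"
    by (auto simp: pq)
  have inner: "(m - 2) * q + q = 2 * r" if "m \<ge> 3"
    using that by (cases p) (auto simp: pq r_def algebra_simps)
  have edges: "card (edges (cylinder m n)) = 8 * r + 4 * p + 2 * q + 1" if "n \<ge> 3"
    using card_edges_cylinder[of m n] that by (simp add: pq r_def algebra_simps)
  have cycle: "int (transversal_number d (cycle_graph n)) = 2 * d + 1"
    if "n \<ge> 3" "1 \<le> d" "d \<le> (int n - 1) div 2"
  proof -
    have "0 \<le> d" using that by linarith
    then obtain D where D: "d = int D" using zero_le_imp_eq_int by blast
    then have "1 \<le> D" "D \<le> (n - 1) div 2" using that D unfolding halves by auto
    then show ?thesis
      using transversal_number_cycle_lower[OF assms(2) that(1), of D]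
        transversal_number_cycle_upper[OF assms(2) that(1), of D] D by (simp add: le_antisym)
  qed
  have lower: "max (3 * d) (4 * d - int n + 2) \<le> int (transversal_number d (cylinder m n))"
    if "m \<ge> 3" "n \<ge> 3" "1 \<le> d" "d \<le> int (2 * r + p + q)"
  proof -
    have "0 \<le> d" using that by linarith
    then obtain D where D: "d = int D" using zero_le_imp_eq_int by blast
    then have "1 \<le> D" "D \<le> (m * n - 1) div 2" using that D unfolding \<nu> by auto
    then show ?thesis
      using three_d_le_transversal_number_cylinder[OF assms(1) that(1) assms(2) that(2), of D]
        four_d_le_transversal_number_cylinder[OF assms that(2), of D] D by simp
  qed
  have small: "int (transversal_number d (cylinder m n)) \<le> 4 * d + 1"
    if "m \<ge> 3" "n \<ge> 3" "1 \<le> d" "d \<le> int (2 * r + p + q)"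
  proof -
    have "0 \<le> d" using that by linarith
    then obtain D where D: "d = int D" using zero_le_imp_eq_int by blast
    then have "1 \<le> D" "D \<le> (m * n - 1) div 2" using that D unfolding \<nu> by auto
    then show ?thesis
      using transversal_number_cylinder_le_lexicographic[OF assms that(2), of D] D by simp
  qed
  have middle: "int (transversal_number d (cylinder m n)) \<le> 3 * d + (int p + 1)"
    if "m \<ge> 3" "n \<ge> 3" "int p \<le> d" "d \<le> int p - 2 + int n"
  proof -
    have "0 \<le> d" using that by linarith
    then obtain D where D: "d = int D" using zero_le_imp_eq_int by blast
    have "D + (m - 2) * q \<le> 2 * r + p + q"
      using inner[OF that(1)] that D pq by linarith
    then obtain k where "2 * r + p + q = D + (m - 2) * q + k" using le_Suc_ex by blast
    then have k: "D + ((m - 2) * q + k) = 2 * r + p + q" by simp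
    have "1 \<le> D" using that D pq by linarith
    have "k \<le> n - 1" using k inner[OF that(1)] that D pq by linarith
    then have "transversal_number d (cylinder m n) + (4 * ((m - 2) * q) + 3 * k) \<le> 8 * r + 4 * p + 2 * q + 1"
      using transversal_number_cylinder_le_outer[OF assms(1) that(1) assms(2) that(2) \<open>1 \<le> D\<close> _ \<open>k \<le> n - 1\<close>,
          unfolded \<nu> halves edges[OF that(2)]] k unfolding D by blast
    then show ?thesis using k inner[OF that(1)] D by linarith
  qed
  have large: "int (transversal_number d (cylinder m n)) \<le> 4 * d - int n + 2"
    if "m \<ge> 3" "n \<ge> 3" "int p - 1 + int n \<le> d" "d \<le> int (2 * r + p + q)"
  proof -
    have "0 \<le> d" using that by linarith
    then obtain D where D: "d = int D" using zero_le_imp_eq_int by blast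
    have "D \<le> 2 * r + p + q" using that D by linarith
    then obtain k where k: "D + k = 2 * r + p + q" using le_Suc_ex by metis
    have "1 \<le> D" using that D by linarith
    have "k \<le> (m - 2) * q" using k inner[OF that(1)] that D pq by linarith
    then have "transversal_number d (cylinder m n) + 4 * k \<le> 8 * r + 4 * p + 2 * q + 1"
      using transversal_number_cylinder_le_inner[OF assms(1) that(1) assms(2) that(2) \<open>1 \<le> D\<close>, of k,
          unfolded \<nu> halves edges[OF that(2)]] k unfolding D by blast
    then show ?thesis using k D pq by linarith
  qed
  show ?thesis
  proof (intro conjI[OF _ impI] impI, goal_cases)
    case 1
    then show ?case using cycle by blast
  next
    case 2
    then have mn: "m \<ge> 3" "n \<ge> 3" by auto
    then have "1 \<le> p" "1 \<le> q" using pq by auto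
    have "max (3 * d) (4 * d - int n + 2) \<le> int (transversal_number d (cylinder m n)) \<and>
           int (transversal_number d (cylinder m n)) \<le> 4 * d + 1"
      if "1 \<le> d" "d \<le> int p - 1"
      using lower small mn that by simp
    moreover have "max (3 * d) (4 * d - int n + 2) \<le> int (transversal_number d (cylinder m n)) \<and>
           int (transversal_number d (cylinder m n)) \<le> 3 * d + (int p + 1)"
      if "int p \<le> d" "d \<le> int p - 2 + int n"
    proof -
      have "1 \<le> d" "d \<le> int (2 * r + p + q)"
        using that \<open>1 \<le> p\<close> r[OF mn] pq by linarith+
      then show ?thesis using lower middle mn that by simp
    qed
    moreover have "int (transversal_number d (cylinder m n)) = 4 * d - int n + 2"
      if "int p - 1 + int n \<le> d" "d \<le> int (2 * r + p + q)"
    proof -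
      have "1 \<le> d" using that \<open>1 \<le> p\<close> mn by linarith
      then show ?thesis using lower large mn that by fastforce
    qed
    ultimately show ?case unfolding halves \<nu>_int by (simp only: of_nat_add of_nat_1) blast
  qed
qed

end
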